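(* Let $\Omega\subset\mathbb{R}^d$ be a bounded Lipschitz domain, $0<T<\infty$ and $y_0\in H^1(\Omega)$. Let $A\in C^1(\mathbb{R}^d)$ be such that, for constants $C_A,\overline{C}_A>0$, $(A'(p)-A'(q),p-q)\ge C_A|p-q|^2$ and $|A'(p)|\le\overline{C}_A|p|$ for all $p,q\in\mathbb{R}^d$. Let $\psi\in C^1(\mathbb{R})$ be bounded from below with $\psi(y_0)\in L^1(\Omega)$, and suppose there are constants $c,C_\psi\ge0$, $C_n\ge0$ $(n\in\mathbb{N})$ and functions $f_n\in C^2(\mathbb{R})$ with $f_n\to\psi$ in $C^1_{\mathrm{loc}}(\mathbb{R})$, $-c\le f_n\le c(\psi+1)$, $f_n''\ge-C_\psi$ and $|f_n''|\le C_n$ on $\mathbb{R}$. Let $\tau=\max_j\tau_j\le 2/C_\psi$. Then the scheme $$(y_j,\varphi)+\tau_j(A'(\nabla y_j),\nabla\varphi)+\tau_j(\psi'(y_j),\varphi)=\tau_j(u_j,\varphi)+(y_{j-1},\varphi)\qquad\forall\varphi\in H^1(\Omega),\ j=1,\dots,N,$$ with $y_\tau(0,\cdot)=y_0$, is energy stable: if $u_\tau=0$ and $y_\tau\in Y_\tau$ is a solution, then the energy $$\mathcal{E}(y)=\int_\Omega A(\nabla y)+\psi(y)\,\mathrm dx$$ is decreasing in time, i.e. $\mathcal{E}(y_j)\le\mathcal{E}(y_{j-1})$ for all $j=1,\dots,N$.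
   Context: $A'$ denotes the gradient of $A$; $(\cdot,\cdot)$ is the $L^2(\Omega)$ (or Euclidean) scalar product. Convention: $1/C_\psi:=\infty$ if $C_\psi=0$ (so there is no restriction on $\tau$ in that case). Time discretization: for $0=t_0<t_1<\dots<t_N=T$ put $I_j=(t_{j-1},t_j]$, $\tau_j=t_j-t_{j-1}$, $\tau=\max_j\tau_j$. With $Q=[0,T]\times\Omega$, $Y_\tau$ is the set of $y_\tau:Q\to\mathbb{R}$ with $y_\tau(t,\cdot)\in H^1(\Omega)$ for all $t$ and $y_\tau(\cdot,x)$ constant on each $I_j$ (for a.e. $x$). One writes $y_j:=y_{\tau|I_j}$, $u_j:=u_{\tau|I_j}$ (for a control $u_\tau$ that is piecewise constant in time with values in $L^2(\Omega)$), and $y_0=y_\tau(0,\cdot)$. *)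

theory Defs
  imports "HOL-Analysis.Analysis"
begin

section \<open>Functions of class $C^k$ and test functions\<close>

primrec Ck :: "nat \<Rightarrow> ('a::euclidean_space \<Rightarrow> real) \<Rightarrow> bool" where
  "Ck 0 f \<longleftrightarrow> continuous_on UNIV f"
| "Ck (Suc k) f \<longleftrightarrow>
     (\<forall>x. f differentiable (at x)) \<and> (\<forall>i\<in>Basis. Ck k (\<lambda>x. frechet_derivative f (at x) i))"

definition test_functions :: "'a::euclidean_space set \<Rightarrow> ('a \<Rightarrow> real) set" where
  "test_functions \<Omega> = {\<phi>. (\<forall>k. Ck k \<phi>) \<and>
     compact (closure {x. \<phi> x \<noteq> 0}) \<and> closure {x. \<phi> x \<noteq> 0} \<subseteq> \<Omega>}"

text \<open>Convergence in $C^1_{\mathrm{loc}}(\mathbb{R})$.\<close>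
definition C1_loc_tendsto :: "(nat \<Rightarrow> real \<Rightarrow> real) \<Rightarrow> (real \<Rightarrow> real) \<Rightarrow> bool" where
  "C1_loc_tendsto f g \<longleftrightarrow> (\<forall>K. compact K \<longrightarrow>
     uniform_limit K f g sequentially \<and>
     uniform_limit K (\<lambda>n. deriv (f n)) (deriv g) sequentially)"

section \<open>Bounded Lipschitz domains\<close>

text \<open>
  Near every boundary point \<open>p\<close> the domain is the strict epigraph of a Lipschitz function
  \<open>\<gamma>\<close>. The unit vector \<open>\<nu>\<close> is the last axis of the local orthonormal frame, so
  \<open>x \<bullet> \<nu>\<close> is the last coordinate and \<open>x - (x \<bullet> \<nu>) *\<^sub>R \<nu>\<close>
  represents the others. Only the values of \<open>\<gamma>\<close> on the hyperplane orthogonal to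
  \<open>\<nu>\<close> matter.
\<close>
definition bounded_lipschitz_domain :: "'a::euclidean_space set \<Rightarrow> bool" where
  "bounded_lipschitz_domain \<Omega> \<longleftrightarrow>
     open \<Omega> \<and> connected \<Omega> \<and> \<Omega> \<noteq> {} \<and> bounded \<Omega> \<and>
     (\<forall>p\<in>frontier \<Omega>. \<exists>\<nu> r L \<gamma>. norm \<nu> = 1 \<and> r > 0 \<and>
        L-lipschitz_on {z. z \<bullet> \<nu> = 0} \<gamma> \<and>
        \<Omega> \<inter> ball p r = {x \<in> ball p r. x \<bullet> \<nu> > \<gamma> (x - (x \<bullet> \<nu>) *\<^sub>R \<nu>)})"

section \<open>The spaces $L^2(\Omega)$ and $H^1(\Omega)$\<close>

text \<open>
  Elements are represented by functions on the whole space of which only the values on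
  \<open>\<Omega>\<close>, up to null sets, are relevant.
\<close>
definition L2_space :: "'a::euclidean_space set \<Rightarrow> ('a \<Rightarrow> 'b::euclidean_space) set" where
  "L2_space \<Omega> = {f \<in> borel_measurable (lebesgue_on \<Omega>).
     integrable (lebesgue_on \<Omega>) (\<lambda>x. (norm (f x))\<^sup>2)}"

definition L2_inner ::
  "'a::euclidean_space set \<Rightarrow> ('a \<Rightarrow> 'b::euclidean_space) \<Rightarrow> ('a \<Rightarrow> 'b) \<Rightarrow> real" where
  "L2_inner \<Omega> f g = (\<integral>x. f x \<bullet> g x \<partial>lebesgue_on \<Omega>)"

definition has_weak_gradient ::
  "'a::euclidean_space set \<Rightarrow> ('a \<Rightarrow> real) \<Rightarrow> ('a \<Rightarrow> 'a) \<Rightarrow> bool" where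
  "has_weak_gradient \<Omega> y g \<longleftrightarrow> (\<forall>\<phi>\<in>test_functions \<Omega>. \<forall>i\<in>Basis.
     (\<integral>x. y x * frechet_derivative \<phi> (at x) i \<partial>lebesgue_on \<Omega>) =
     - (\<integral>x. (g x \<bullet> i) * \<phi> x \<partial>lebesgue_on \<Omega>))"

definition H1_space :: "'a::euclidean_space set \<Rightarrow> ('a \<Rightarrow> real) set" where
  "H1_space \<Omega> = {y \<in> L2_space \<Omega>. \<exists>g\<in>L2_space \<Omega>. has_weak_gradient \<Omega> y g}"

text \<open>
  For \<open>y\<close> in \<open>H1_space \<Omega>\<close> this is a representative of the weak gradient, which is
  determined up to null sets.
\<close>
definition weak_gradient ::
  "'a::euclidean_space set \<Rightarrow> ('a \<Rightarrow> real) \<Rightarrow> 'a \<Rightarrow> 'a" where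
  "weak_gradient \<Omega> y = (SOME g. g \<in> L2_space \<Omega> \<and> has_weak_gradient \<Omega> y g)"

section \<open>Time discretization, scheme and energy\<close>

definition time_grid :: "real \<Rightarrow> nat \<Rightarrow> (nat \<Rightarrow> real) \<Rightarrow> bool" where
  "time_grid T N t \<longleftrightarrow> t 0 = 0 \<and> t N = T \<and> (\<forall>j\<in>{1..N}. t (j - 1) < t j)"

definition step_size :: "(nat \<Rightarrow> real) \<Rightarrow> nat \<Rightarrow> real" where
  "step_size t j = t j - t (j - 1)"

definition max_step :: "nat \<Rightarrow> (nat \<Rightarrow> real) \<Rightarrow> real" where
  "max_step N t = Max (step_size t ` {1..N})"

definition Y_space ::
  "'a::euclidean_space set \<Rightarrow> real \<Rightarrow> nat \<Rightarrow> (nat \<Rightarrow> real) \<Rightarrow> (real \<Rightarrow> 'a \<Rightarrow> real) set" where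
  "Y_space \<Omega> T N t = {y. (\<forall>s\<in>{0..T}. y s \<in> H1_space \<Omega>) \<and>
     (AE x in lebesgue_on \<Omega>. \<forall>j\<in>{1..N}. (\<lambda>s. y s x) constant_on {t (j - 1)<..t j})}"

text \<open>
  The value of a piecewise constant function on the interval $(t_{j-1}, t_j]$ is read off at
  the right end point, so \<open>y (t j)\<close> is $y_j$ and \<open>u (t j)\<close> is $u_j$; moreover
  \<open>y (t 0)\<close> is $y_\tau(0,\cdot)$. The initial condition is an identity in
  $H^1(\Omega)$, hence almost everywhere. That the term $(\psi'(y_j),\varphi)$ makes sense is
  part of being a solution: a non-integrable function would have Bochner integral \<open>0\<close>.
  All other terms are integrable for \<open>y\<close> in \<open>Y_space\<close>, square integrable
  \<open>u (t j)\<close> and continuous \<open>A'\<close> of linear growth.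
\<close>
definition scheme_solution ::
  "'a::euclidean_space set \<Rightarrow> ('a \<Rightarrow> 'a) \<Rightarrow> (real \<Rightarrow> real) \<Rightarrow> nat \<Rightarrow> (nat \<Rightarrow> real) \<Rightarrow>
   ('a \<Rightarrow> real) \<Rightarrow> (real \<Rightarrow> 'a \<Rightarrow> real) \<Rightarrow> (real \<Rightarrow> 'a \<Rightarrow> real) \<Rightarrow> bool" where
  "scheme_solution \<Omega> A' \<psi>' N t y0 u y \<longleftrightarrow>
     (AE x in lebesgue_on \<Omega>. y 0 x = y0 x) \<and>
     (\<forall>j\<in>{1..N}. \<forall>\<phi>\<in>H1_space \<Omega>.
        integrable (lebesgue_on \<Omega>) (\<lambda>x. \<psi>' (y (t j) x) * \<phi> x) \<and>
        L2_inner \<Omega> (y (t j)) \<phi>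
          + step_size t j * L2_inner \<Omega> (\<lambda>x. A' (weak_gradient \<Omega> (y (t j)) x)) (weak_gradient \<Omega> \<phi>)
          + step_size t j * L2_inner \<Omega> (\<lambda>x. \<psi>' (y (t j) x)) \<phi>
        = step_size t j * L2_inner \<Omega> (u (t j)) \<phi> + L2_inner \<Omega> (y (t (j - 1))) \<phi>)"

definition energy_density ::
  "'a::euclidean_space set \<Rightarrow> ('a \<Rightarrow> real) \<Rightarrow> (real \<Rightarrow> real) \<Rightarrow> ('a \<Rightarrow> real) \<Rightarrow> 'a \<Rightarrow> real" where
  "energy_density \<Omega> A \<psi> y x = A (weak_gradient \<Omega> y x) + \<psi> (y x)"

definition energy ::
  "'a::euclidean_space set \<Rightarrow> ('a \<Rightarrow> real) \<Rightarrow> (real \<Rightarrow> real) \<Rightarrow> ('a \<Rightarrow> real) \<Rightarrow> real" where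
  "energy \<Omega> A \<psi> y = (\<integral>x. energy_density \<Omega> A \<psi> y x \<partial>lebesgue_on \<Omega>)"

end

theory Submission
  imports Defs "HOL-Computational_Algebra.Polynomial"
begin

text \<open>
  Test the scheme with \<open>\<phi> = y\<^sub>j - y\<^sub>j\<^sub>-\<^sub>1\<close>. Convexity of \<open>A\<close> bounds
  \<open>A(\<nabla>y\<^sub>j) - A(\<nabla>y\<^sub>j\<^sub>-\<^sub>1)\<close> by
  \<open>A'(\<nabla>y\<^sub>j) \<bullet> \<nabla>\<phi>\<close>. The functions \<open>f\<^sub>n + (C\<^sub>\<psi> / 2) s\<^sup>2\<close> are convex, hence so is
  \<open>\<psi> + (C\<^sub>\<psi> / 2) s\<^sup>2\<close>, and \<open>\<psi>(y\<^sub>j) - \<psi>(y\<^sub>j\<^sub>-\<^sub>1)\<close> is at most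
  \<open>\<psi>'(y\<^sub>j) \<phi> + (C\<^sub>\<psi> / 2) \<phi>\<^sup>2\<close>. Integrated, the energy increment is at
  most \<open>(C\<^sub>\<psi> / 2 - 1 / \<tau>\<^sub>j) (\<phi>, \<phi>) \<le> 0\<close>. The same pointwise bound and the lower bound on
  \<open>\<psi>\<close> give integrability of \<open>\<psi>(y\<^sub>j)\<close>, by induction on \<open>j\<close>.
  As the weak gradient is only a chosen representative, \<open>\<nabla>\<phi> = \<nabla>y\<^sub>j - \<nabla>y\<^sub>j\<^sub>-\<^sub>1\<close> requires
  its uniqueness almost everywhere.
\<close>

section \<open>The fundamental lemma of the calculus of variations\<close>

lemma Ck_SucD: "Ck (Suc k) f \<Longrightarrow> Ck k f"
proof (induction k arbitrary: f)
  case 0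
  then show ?case
    by (auto simp: continuous_at_imp_continuous_on differentiable_imp_continuous_within)
next
  case (Suc k)
  from Suc.prems have "\<forall>x. f differentiable (at x)"
    "\<forall>i\<in>Basis. Ck (Suc k) (\<lambda>x. frechet_derivative f (at x) i)"
    by auto
  with Suc.IH show ?case by auto
qed

text \<open>\<open>frechet_derivative\<close> is a choice operator; uniqueness of derivatives lets
  any explicit formula \<open>D\<close> take its place in the recursion of
  \<open>Ck\<close>.\<close>

lemma Ck_SucI:
  assumes "\<And>x. (f has_derivative D x) (at x)"
    and "\<And>i. i \<in> Basis \<Longrightarrow> Ck k (\<lambda>x. D x i)"
  shows "Ck (Suc k) f"
proof -
  have "frechet_derivative f (at x) = D x" for x
    using assms(1) frechet_derivative_at by metis
  with assms show ?thesis by (auto simp: differentiable_def)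
qed

lemma Ck_Suc_has_derivative:
  "Ck (Suc k) f \<Longrightarrow> (f has_derivative frechet_derivative f (at x)) (at x)"
  by (simp add: frechet_derivative_works)

lemma Ck_const: "Ck k (\<lambda>x. c)"
proof (induction k arbitrary: c)
  case (Suc k)
  show ?case by (rule Ck_SucI[where D="\<lambda>x h. 0"]) (auto intro: Suc)
qed simp

lemma Ck_add: "Ck k f \<Longrightarrow> Ck k g \<Longrightarrow> Ck k (\<lambda>x. f x + g x)"
proof (induction k arbitrary: f g)
  case 0
  then show ?case by (auto intro: continuous_intros)
next
  case (Suc k)
  show ?case
  proof (rule Ck_SucI)
    show "((\<lambda>x. f x + g x) has_derivative
        (\<lambda>h. frechet_derivative f (at x) h + frechet_derivative g (at x) h)) (at x)" for x
      using Suc.prems by (intro has_derivative_add Ck_Suc_has_derivative)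
  qed (use Suc in auto)
qed

lemma Ck_mult: "Ck k f \<Longrightarrow> Ck k g \<Longrightarrow> Ck k (\<lambda>x. f x * g x)"
proof (induction k arbitrary: f g)
  case 0
  then show ?case by (auto intro: continuous_intros)
next
  case (Suc k)
  show ?case
  proof (rule Ck_SucI)
    show "((\<lambda>x. f x * g x) has_derivative
        (\<lambda>h. f x * frechet_derivative g (at x) h + frechet_derivative f (at x) h * g x)) (at x)" for x
      using Suc.prems by (intro has_derivative_mult Ck_Suc_has_derivative)
    \<comment> \<open>The product rule brings back the undifferentiated factors;
      \<open>Ck_SucD\<close> lowers them to order \<open>k\<close> so that the induction hypothesis
      applies.\<close>
    show "Ck k (\<lambda>x. f x * frechet_derivative g (at x) i + frechet_derivative f (at x) i * g x)"
      if "i \<in> Basis" for i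
      using Suc.prems[THEN Ck_SucD] Suc.prems that by (intro Ck_add Suc.IH) auto
  qed
qed

lemma Ck_prod: "(\<And>i. i \<in> I \<Longrightarrow> Ck k (f i)) \<Longrightarrow> Ck k (\<lambda>x. \<Prod>i\<in>I. f i x)"
  by (induction I rule: infinite_finite_induct) (auto intro: Ck_const Ck_mult)

section \<open>Smooth bumps approximating indicators of boxes\<close>

text \<open>
  The functions \<open>flat p\<close> form a family closed under differentiation, which makes
  \<open>flat 1\<close> smooth; dilating \<open>flat 1\<close> turns the bumps below into approximations of
  the indicator of a box.
\<close>
definition flat :: "real poly \<Rightarrow> real \<Rightarrow> real" where
  "flat p s = (if s > 0 then poly p (1 / s) * exp (- 1 / s) else 0)"

lemma flat_1: "flat 1 s = (if s > 0 then exp (- 1 / s) else 0)"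
  by (simp add: flat_def)

lemma flat_1_bounds: "0 \<le> flat 1 s" "flat 1 s \<le> 1"
  by (auto simp: flat_1)

lemma flat_1_eq_0_iff: "flat 1 s = 0 \<longleftrightarrow> s \<le> 0"
  by (auto simp: flat_1)

lemma tendsto_poly_mult_exp_minus: "((\<lambda>x::real. poly p x * exp (- x)) \<longlongrightarrow> 0) at_top"
proof -
  have "((\<lambda>x::real. \<Sum>i\<le>degree p. coeff p i * (x ^ i / exp x)) \<longlongrightarrow> (\<Sum>i\<le>degree p. coeff p i * 0)) at_top"
    by (intro tendsto_intros tendsto_power_div_exp_0)
  then show ?thesis
    by (simp add: poly_altdef sum_distrib_right sum_divide_distrib exp_minus field_simps)
qed

text \<open>As \<open>flat p 0 = 0\<close>, this is the difference quotient at 0, the one point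
  where the two branches meet.\<close>

lemma flat_over_id_tendsto_0: "((\<lambda>s. flat p s / s) \<longlongrightarrow> 0) (at 0)"
proof (subst filterlim_at_split, intro conjI)
  have "((\<lambda>s. flat p s / s) \<longlongrightarrow> 0) (at_left 0) \<longleftrightarrow> ((\<lambda>s::real. 0::real) \<longlongrightarrow> 0) (at_left 0)"
    by (rule filterlim_cong) (auto simp: flat_def eventually_at_filter)
  then show "((\<lambda>s. flat p s / s) \<longlongrightarrow> 0) (at_left 0)" by simp
  \<comment> \<open>With r = 1 / s the extra factor 1 / s multiplies the polynomial by its variable,
    which is \<open>pCons 0 p\<close>, and the limit moves to infinity.\<close>
  have "((\<lambda>s. poly (pCons 0 p) (inverse s) * exp (- inverse s)) \<longlongrightarrow> 0) (at_right (0::real))"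
    by (rule filterlim_compose[OF tendsto_poly_mult_exp_minus filterlim_inverse_at_top_right])
  moreover have "((\<lambda>s. flat p s / s) \<longlongrightarrow> 0) (at_right 0) \<longleftrightarrow>
      ((\<lambda>s. poly (pCons 0 p) (inverse s) * exp (- inverse s)) \<longlongrightarrow> 0) (at_right (0::real))"
    by (rule filterlim_cong) (auto simp: flat_def eventually_at_filter divide_simps)
  ultimately show "((\<lambda>s. flat p s / s) \<longlongrightarrow> 0) (at_right 0)" by simp
qed

text \<open>For s > 0 and r = 1 / s, differentiating p(r) exp(-r) gives r^2 (p(r) - p'(r)) exp(-r),
  since dr/ds = -r^2; hence the polynomial \<open>[:0, 0, 1:] * (p - pderiv p)\<close>. To the left
  of 0 everything vanishes, and at 0 the difference quotient tends to 0.\<close>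

lemma has_real_derivative_flat:
  "(flat p has_real_derivative flat ([:0, 0, 1:] * (p - pderiv p)) s) (at s)"
proof (cases s "0::real" rule: linorder_cases)
  case less
  have "(flat p has_real_derivative 0) (at s) \<longleftrightarrow> ((\<lambda>s. 0) has_real_derivative 0) (at s)"
    by (rule DERIV_cong_ev)
      (use less in \<open>auto simp: flat_def intro!: eventually_mono[OF eventually_nhds_in_open[of "{..<0}"]]\<close>)
  with less show ?thesis by (simp add: flat_def)
next
  case equal
  with flat_over_id_tendsto_0[of p] show ?thesis
    by (simp add: has_field_derivative_iff flat_def)
next
  case greater
  have "((\<lambda>s. poly p (1 / s) * exp (- 1 / s)) has_real_derivative
      flat ([:0, 0, 1:] * (p - pderiv p)) s) (at s)"
    using greater
    by (auto intro!: derivative_eq_intros DERIV_chain'[OF _ poly_DERIV]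
        simp: flat_def field_simps power2_eq_square)
  moreover have "(flat p has_real_derivative flat ([:0, 0, 1:] * (p - pderiv p)) s) (at s) \<longleftrightarrow>
      ((\<lambda>s. poly p (1 / s) * exp (- 1 / s)) has_real_derivative
      flat ([:0, 0, 1:] * (p - pderiv p)) s) (at s)"
    by (rule DERIV_cong_ev)
      (use greater in \<open>auto simp: flat_def intro!: eventually_mono[OF eventually_nhds_in_open[of "{0<..}"]]\<close>)
  ultimately show ?thesis by simp
qed

lemma Ck_flat: "Ck k (\<lambda>x. flat p (c * (x \<bullet> v) + d))"
\<comment> \<open>\<open>p\<close> must vary: a derivative of \<open>flat p\<close> is
  \<open>flat\<close> of another polynomial, up to an inner factor that is constant in
  \<open>x\<close>.\<close>
proof (induction k arbitrary: p)
  case 0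
  have "continuous_on UNIV (flat p)"
    using has_real_derivative_flat by (intro DERIV_continuous_on) auto
  then show ?case
    by (auto intro!: continuous_on_compose2[of UNIV "flat p"] continuous_intros)
next
  case (Suc k)
  show ?case
  proof (rule Ck_SucI)
    show "((\<lambda>x. flat p (c * (x \<bullet> v) + d)) has_derivative
      (\<lambda>h. (c * (h \<bullet> v)) * flat ([:0, 0, 1:] * (p - pderiv p)) (c * (x \<bullet> v) + d))) (at x)" for x
      by (rule DERIV_compose_FDERIV[OF has_real_derivative_flat])
        (auto intro!: derivative_eq_intros)
  qed (intro Ck_mult Ck_const Suc)
qed

text \<open>Each argument has the form \<open>c * (x \<bullet> v) + d\<close> required by
  \<open>Ck_flat\<close>. For each \<open>i\<close>, one factor is positive exactly where
  \<open>x \<bullet> i\<close> exceeds \<open>a \<bullet> i\<close>, the other exactly where it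
  stays below \<open>b \<bullet> i\<close>; the scale \<open>Suc n\<close>, positive also for n = 0,
  drives them to 1 there.\<close>

definition box_bump :: "'a::euclidean_space \<Rightarrow> 'a \<Rightarrow> nat \<Rightarrow> 'a \<Rightarrow> real" where
  "box_bump a b n x = (\<Prod>i\<in>Basis.
     flat 1 (real (Suc n) * (x \<bullet> i) + - (real (Suc n) * (a \<bullet> i))) *
     flat 1 (- real (Suc n) * (x \<bullet> i) + real (Suc n) * (b \<bullet> i)))"

lemma Ck_box_bump: "Ck k (box_bump a b n)"
  unfolding box_bump_def[abs_def] by (intro Ck_prod Ck_mult Ck_flat)

lemma box_bump_bounds: "0 \<le> box_bump a b n x" "box_bump a b n x \<le> 1"
  unfolding box_bump_def
  by (auto intro!: prod_nonneg prod_le_1 mult_nonneg_nonneg mult_le_one flat_1_bounds)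

lemma flat_1_scaled_eq_0_iff:
  "flat 1 (real (Suc n) * s + - (real (Suc n) * r)) = 0 \<longleftrightarrow> s \<le> r"
  "flat 1 (- real (Suc n) * s + real (Suc n) * r) = 0 \<longleftrightarrow> r \<le> s"
  unfolding flat_1_eq_0_iff by (auto simp del: of_nat_Suc)

lemma box_bump_eq_0_iff: "box_bump a b n x = 0 \<longleftrightarrow> x \<notin> box a b"
  unfolding box_bump_def prod_zero_iff[OF finite_Basis] mult_eq_0_iff flat_1_scaled_eq_0_iff
  by (auto simp: mem_box not_less)

lemma flat_1_tendsto_1:
  assumes "s > 0"
  shows "(\<lambda>n. flat 1 (real (Suc n) * s)) \<longlonglongrightarrow> 1"
proof -
  have "(\<lambda>n. exp (- (inverse (real (Suc n)) * (1 / s)))) \<longlonglongrightarrow> exp (- (0 * (1 / s)))"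
    by (intro tendsto_intros LIMSEQ_inverse_real_of_nat)
  moreover have "flat 1 (real (Suc n) * s) = exp (- (inverse (real (Suc n)) * (1 / s)))" for n
    using assms by (simp add: flat_1 field_simps del: of_nat_Suc)
  ultimately show ?thesis by simp
qed

lemma box_bump_tendsto_indicator: "(\<lambda>n. box_bump a b n x) \<longlonglongrightarrow> indicator (box a b) x"
proof (cases "x \<in> box a b")
  case True
  have "(\<lambda>n. \<Prod>i\<in>Basis. flat 1 (real (Suc n) * (x \<bullet> i - a \<bullet> i)) *
      flat 1 (real (Suc n) * (b \<bullet> i - x \<bullet> i))) \<longlonglongrightarrow> (\<Prod>i\<in>(Basis::'a set). 1 * 1)"
    using True by (intro tendsto_prod tendsto_mult flat_1_tendsto_1) (auto simp: mem_box)
  then have "(\<lambda>n. box_bump a b n x) \<longlonglongrightarrow> (\<Prod>i\<in>(Basis::'a set). 1 * 1)"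
    unfolding box_bump_def by (simp add: algebra_simps del: of_nat_Suc)
  with True show ?thesis by simp
next
  case False
  then have "box_bump a b n x = 0" for n by (simp add: box_bump_eq_0_iff)
  with False show ?thesis by simp
qed

text \<open>The support is the closure of the open box; it lies in the closed box and is therefore a
  compact subset of \<Omega>.\<close>

lemma box_bump_in_test_functions:
  assumes "cbox a b \<subseteq> \<Omega>"
  shows "box_bump a b n \<in> test_functions \<Omega>"
proof -
  have "{x. box_bump a b n x \<noteq> 0} = box a b"
    by (auto simp: box_bump_eq_0_iff)
  moreover have "closure (box a b) \<subseteq> cbox a b"
    by (intro closure_minimal box_subset_cbox closed_cbox)
  ultimately show ?thesis
    using assms by (auto simp: test_functions_def Ck_box_bump compact_closure)
qed

text \<open>The Borel sets over which \<open>h\<close> integrates to 0 form a Dynkin system, and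
  open boxes are an intersection-stable generator of the Borel sets. Hence the integral vanishes
  over every Borel set, which forces \<open>h\<close> to be 0 almost everywhere.\<close>

lemma AE_zero_if_integral_box_zero:
  fixes h :: "'a::euclidean_space \<Rightarrow> real"
  assumes h: "integrable lborel h"
    and box0: "\<And>a b. (\<integral>x. indicator (box a b) x * h x \<partial>lborel) = 0"
  shows "AE x in lborel. h x = 0"
proof (rule sigma_finite_measure.density_zero[OF lborel.sigma_finite_measure_axioms h])
  have int: "integrable lborel (\<lambda>x. indicator A x * h x)" if "A \<in> sets borel" for A
    using integrable_mult_indicator[of A lborel h] h that by simp
  have [measurable]: "h \<in> borel_measurable borel" using h by (auto simp: integrable_iff_bounded)
  \<comment> \<open>The complement case below needs the total integral; it is a limit over centred
    boxes exhausting the space.\<close>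
  have tot: "(\<integral>x. h x \<partial>lborel) = 0"
  proof (rule LIMSEQ_unique)
    show "(\<lambda>n. \<integral>x. indicator (box (- (real n *\<^sub>R One)) (real n *\<^sub>R One)) x * h x \<partial>lborel)
        \<longlonglongrightarrow> (\<integral>x. h x \<partial>lborel)"
    proof (rule integral_dominated_convergence[where w="\<lambda>x. norm (h x)"])
      show "AE x in lborel. (\<lambda>n. indicator (box (- (real n *\<^sub>R One)) (real n *\<^sub>R One)) x * h x) \<longlonglongrightarrow> h x"
      proof (rule AE_I2)
        fix x :: 'a
        obtain n0 where n0: "x \<in> box (- (real n0 *\<^sub>R One)) (real n0 *\<^sub>R One)"
          using UN_box_eq_UNIV[where 'a='a] by blast
        have "\<forall>\<^sub>F n in sequentially. indicator (box (- (real n *\<^sub>R One)) (real n *\<^sub>R One)) x * h x = h x"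
          using eventually_ge_at_top[of n0]
        proof eventually_elim
          case (elim n)
          with n0 have "x \<in> box (- (real n *\<^sub>R One)) (real n *\<^sub>R One)"
            by (force simp: mem_box)
          then show ?case by simp
        qed
        then show "(\<lambda>n. indicator (box (- (real n *\<^sub>R One)) (real n *\<^sub>R One)) x * h x) \<longlonglongrightarrow> h x"
          by (rule tendsto_eventually)
      qed
    qed (use h in \<open>auto simp: indicator_def\<close>)
  qed (simp add: box0)
  fix A :: "'a set" assume "A \<in> sets lborel"
  then have A: "A \<in> sigma_sets UNIV (range (\<lambda>(a, b). box a b))"
    unfolding sets_lborel borel_eq_box by simp
  have st: "Int_stable (range (\<lambda>(a, b). box a b :: 'a set))"
    by (auto simp: Int_stable_def box_Int_box)
  have pow: "range (\<lambda>(a, b). box a b :: 'a set) \<subseteq> Pow UNIV" by simp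
  have borelI: "B \<in> sets borel" if "B \<in> sigma_sets UNIV (range (\<lambda>(a, b). box a b :: 'a set))" for B
    using that unfolding borel_eq_box by simp
  have "(\<integral>x. indicator A x * h x \<partial>lborel) = 0"
    using st pow A
  proof (induction rule: sigma_sets_induct_disjoint)
    case (basic A)
    then show ?case using box0 by auto
  next
    case (compl A)
    then have "(\<integral>x. h x - indicator A x * h x \<partial>lborel) = 0"
      using int[OF borelI, of A] h tot by simp
    moreover have "indicator (UNIV - A) x * h x = h x - indicator A x * h x" for x
      by (simp add: indicator_def)
    ultimately show ?case by simp
  next
    case (union A)
    then have [measurable]: "A i \<in> sets borel" for i using borelI by auto
    have "set_lebesgue_integral lborel (\<Union>i. A i) h = (\<Sum>i. set_lebesgue_integral lborel (A i) h)"
      using union int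
      by (intro lebesgue_integral_countable_add)
        (auto simp: disjoint_family_on_def set_integrable_def)
    with union show ?case by (simp add: set_lebesgue_integral_def)
  qed auto
  then show "set_lebesgue_integral lborel A h = 0"
    by (simp add: set_lebesgue_integral_def)
qed

text \<open>Boxes generate only the Borel sets, so \<open>h\<close> is first replaced by a Borel
  function agreeing with it almost everywhere.\<close>

lemma AE_zero_if_lebesgue_integral_box_zero:
  fixes h :: "'a::euclidean_space \<Rightarrow> real"
  assumes h: "integrable lebesgue h"
    and box0: "\<And>a b. (\<integral>x. indicator (box a b) x * h x \<partial>lebesgue) = 0"
  shows "AE x in lebesgue. h x = 0"
proof -
  from h have "h \<in> borel_measurable lebesgue" by auto
  then obtain h' where [measurable]: "h' \<in> borel_measurable lborel"
    and "AE x in lborel. h x = h' x"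
    using completion_ex_borel_measurable_real by blast
  then have eq: "AE x in lebesgue. h x = h' x" by (simp add: AE_completion)
  have [measurable]: "h' \<in> borel_measurable lebesgue"
    by (rule measurable_completion) simp
  have [measurable]: "h \<in> borel_measurable lebesgue" by fact
  from h have "integrable lebesgue h'"
    using integrable_cong_AE[OF _ _ eq] by simp
  then have "integrable lborel h'"
    by (simp add: integrable_completion)
  moreover have "(\<integral>x. indicator (box a b) x * h' x \<partial>lborel) = 0" for a b :: 'a
  proof -
    have [measurable]: "(indicator (box a b) :: 'a \<Rightarrow> real) \<in> borel_measurable lebesgue"
      by (intro borel_measurable_indicator) auto
    have "(\<integral>x. indicator (box a b) x * h' x \<partial>lborel) = (\<integral>x. indicator (box a b) x * h' x \<partial>lebesgue)"
      by (rule integral_completion[symmetric]) simp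
    also have "\<dots> = (\<integral>x. indicator (box a b) x * h x \<partial>lebesgue)"
      using eq by (intro integral_cong_AE) auto
    finally show ?thesis by (simp add: box0)
  qed
  ultimately have "AE x in lborel. h' x = 0" by (rule AE_zero_if_integral_box_zero)
  then have "AE x in lebesgue. h' x = 0" by (simp add: AE_completion)
  with eq show ?thesis by auto
qed

text \<open>Bumps turn the hypothesis into vanishing integrals over all open boxes whose closed box
  lies in \<Omega>. The box criterion is then applied inside each member of a countable cover of
  \<Omega> by closed boxes.\<close>

theorem fundamental_lemma_variations:
  fixes h :: "'a::euclidean_space \<Rightarrow> real"
  assumes \<Omega>: "open \<Omega>" and h: "integrable (lebesgue_on \<Omega>) h"
    and test0: "\<And>\<phi>. \<phi> \<in> test_functions \<Omega> \<Longrightarrow> (\<integral>x. h x * \<phi> x \<partial>lebesgue_on \<Omega>) = 0"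
  shows "AE x in lebesgue_on \<Omega>. h x = 0"
proof -
  have \<Omega>L: "\<Omega> \<in> sets lebesgue" using \<Omega> by (simp add: borel_open)
  define g where "g x = indicator \<Omega> x * h x" for x
  have g: "integrable lebesgue g"
    using h \<Omega>L by (simp add: g_def[abs_def] integrable_restrict_space)
  have [measurable]: "g \<in> borel_measurable lebesgue" using g by auto
  have boxm[measurable]: "(indicator (box a b) :: 'a \<Rightarrow> real) \<in> borel_measurable lebesgue" for a b
    by (intro borel_measurable_indicator) auto
  have box0: "(\<integral>x. indicator (box a b) x * g x \<partial>lebesgue) = 0" if "cbox a b \<subseteq> \<Omega>" for a b
  proof (rule LIMSEQ_unique)
    show "(\<lambda>n. \<integral>x. box_bump a b n x * g x \<partial>lebesgue) \<longlonglongrightarrow> (\<integral>x. indicator (box a b) x * g x \<partial>lebesgue)"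
    proof (rule integral_dominated_convergence[where w="\<lambda>x. norm (g x)"])
      show "(\<lambda>x. box_bump a b n x * g x) \<in> borel_measurable lebesgue" for n
      proof -
        have "continuous_on UNIV (box_bump a b n)" using Ck_box_bump[of 0 a b n] by simp
        then have [measurable]: "box_bump a b n \<in> borel_measurable lebesgue"
          by (intro measurable_completion) (simp add: borel_measurable_continuous_onI)
        show ?thesis by simp
      qed
      show "AE x in lebesgue. (\<lambda>n. box_bump a b n x * g x) \<longlonglongrightarrow> indicator (box a b) x * g x"
        by (intro AE_I2 tendsto_intros box_bump_tendsto_indicator)
      show "AE x in lebesgue. norm (box_bump a b n x * g x) \<le> norm (g x)" for n
        by (auto simp: abs_mult box_bump_bounds intro!: mult_left_le_one_le)
    qed (use g in auto)
    have "(\<integral>x. box_bump a b n x * g x \<partial>lebesgue) = 0" for n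
      using test0[OF box_bump_in_test_functions[OF that, of n]] \<Omega>L
      by (simp add: integral_restrict_space g_def mult_ac)
    then show "(\<lambda>n. \<integral>x. box_bump a b n x * g x \<partial>lebesgue) \<longlonglongrightarrow> 0" by simp
  qed
  obtain \<D> where \<D>: "countable \<D>" "\<D> \<subseteq> Pow \<Omega>" "\<And>X. X \<in> \<D> \<Longrightarrow> \<exists>a b. X = cbox a b" "\<Union>\<D> = \<Omega>"
    using open_countable_Union_open_cbox[OF \<Omega>] by blast
  have "AE x in lebesgue. x \<in> D \<longrightarrow> g x = 0" if "D \<in> \<D>" for D
  proof -
    obtain c d where D: "D = cbox c d" using \<D>(3) \<open>D \<in> \<D>\<close> by blast
    then have sub: "cbox c d \<subseteq> \<Omega>" using \<D>(2) \<open>D \<in> \<D>\<close> by auto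
    have "AE x in lebesgue. indicator (box c d) x * g x = 0"
    proof (rule AE_zero_if_lebesgue_integral_box_zero)
      show "integrable lebesgue (\<lambda>x. indicator (box c d) x * g x)"
        using integrable_mult_indicator[of "box c d" lebesgue g] g by simp
      fix a b :: 'a
      \<comment> \<open>The same corners serve both intersections: the open one is the domain of
        integration, the closed one lies in \<open>cbox c d\<close> and hence in \<Omega>, as
        \<open>box0\<close> demands.\<close>
      obtain a' b' where ab: "cbox a b \<inter> cbox c d = cbox a' b'" "box a b \<inter> box c d = box a' b'"
        using Int_interval box_Int_box by (metis (no_types, lifting))
      have "(\<integral>x. indicator (box a b) x * (indicator (box c d) x * g x) \<partial>lebesgue) =
          (\<integral>x. indicator (box a' b') x * g x \<partial>lebesgue)"
        by (simp add: ab(2)[symmetric] indicator_inter_arith mult_ac)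
      also have "\<dots> = 0" using ab(1) sub by (intro box0) auto
      finally show "(\<integral>x. indicator (box a b) x * (indicator (box c d) x * g x) \<partial>lebesgue) = 0" .
    qed
    \<comment> \<open>The criterion covers only the open box; the faces of the closed box
      \<open>D\<close> form a null set.\<close>
    moreover have "AE x in lebesgue. x \<notin> cbox c d - box c d"
      using negligible_frontier_interval[of c d]
      by (intro AE_not_in) (simp add: negligible_iff_null_sets)
    ultimately show ?thesis
      by eventually_elim (auto simp: D indicator_def split: if_splits)
  qed
  then have "AE x in lebesgue. \<forall>D\<in>\<D>. x \<in> D \<longrightarrow> g x = 0"
    using \<D>(1) AE_ball_countable[of \<D> "\<lambda>x D. x \<in> D \<longrightarrow> g x = 0" lebesgue] by blast
  then have "AE x in lebesgue. x \<in> \<Omega> \<longrightarrow> h x = 0"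
    by eventually_elim (use \<D>(4) in \<open>auto simp: g_def indicator_def split: if_splits\<close>)
  then show ?thesis using \<Omega>L by (simp add: AE_restrict_space_iff)
qed

section \<open>Convexity\<close>

lemma Ck_real_DERIV:
  fixes f :: "real \<Rightarrow> real"
  assumes "Ck (Suc k) f"
  shows "(f has_real_derivative deriv f x) (at x)" "Ck k (deriv f)"
proof -
  have D: "(f has_real_derivative deriv f x) (at x)" for x
    using assms by (auto intro: real_differentiableE simp: DERIV_deriv_iff_real_differentiable)
  then have "frechet_derivative f (at x) 1 = deriv f x" for x
    unfolding has_field_derivative_def
    by (metis frechet_derivative_at mult.right_neutral)
  with assms show "Ck k (deriv f)" by auto
  show "(f has_real_derivative deriv f x) (at x)" by (rule D)
qed

text \<open>Adding \<open>K / 2 * s\<^sup>2\<close> makes the second derivative nonnegative, so the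
  sum lies above its tangents; returning to \<open>f\<close> costs exactly the quadratic term in
  \<open>b - a\<close>.\<close>

lemma semiconvex_tangent:
  fixes f :: "real \<Rightarrow> real"
  assumes f: "Ck 2 f" and lb: "\<And>s. deriv (deriv f) s \<ge> - K"
  shows "f b \<ge> f a + deriv f a * (b - a) - K / 2 * (b - a)\<^sup>2"
proof -
  have f2: "Ck (Suc 1) f" using f by (simp add: numeral_2_eq_2)
  have D1: "(f has_real_derivative deriv f x) (at x)" for x
    using Ck_real_DERIV(1)[OF f2] .
  have D2: "(deriv f has_real_derivative deriv (deriv f) x) (at x)" for x
    using Ck_real_DERIV(2)[OF f2] Ck_real_DERIV(1)[of 0 "deriv f"] by simp
  define g where "g s = f s + K / 2 * s\<^sup>2" for s
  have Dg: "(g has_real_derivative deriv f x + K * x) (at x)" for x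
    unfolding g_def by (auto intro!: derivative_eq_intros D1)
  have "convex_on UNIV g"
    by (rule f''_ge0_imp_convex[OF convex_UNIV Dg, where f''="\<lambda>x. deriv (deriv f) x + K"])
      (use lb in \<open>auto intro!: derivative_eq_intros D2 simp: le_minus_iff add.commute[of _ K] real_0_le_add_iff\<close>)
  then have "(deriv f a + K * a) * (b - a) \<le> g b - g a"
    by (rule convex_on_imp_above_tangent) (use Dg in auto)
  \<comment> \<open>A ring identity free of division, used with \<open>k = K / 2\<close>: it splits
    the tangent term of the added parabola so that linear arithmetic suffices.\<close>
  moreover have "2 * k * a * (b - a) = k * b\<^sup>2 - k * a\<^sup>2 - k * (b - a)\<^sup>2" for k
    by algebra
  from this[of "K / 2"] have "K * a * (b - a) = K / 2 * b\<^sup>2 - K / 2 * a\<^sup>2 - K / 2 * (b - a)\<^sup>2"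
    by simp
  ultimately show ?thesis unfolding g_def distrib_right by linarith
qed

text \<open>The tangent inequality contains only first derivatives, so it passes to the C^1_loc
  limit, where a second derivative need not exist. Compactness of singletons gives the pointwise
  limits.\<close>

lemma semiconvex_tangent_limit:
  assumes f: "\<And>n. Ck 2 (f n)" and lb: "\<And>n s. deriv (deriv (f n)) s \<ge> - K"
    and lim: "C1_loc_tendsto f g"
  shows "g b \<ge> g a + deriv g a * (b - a) - K / 2 * (b - a)\<^sup>2"
proof (rule LIMSEQ_le)
  have pt: "(\<lambda>n. f n s) \<longlonglongrightarrow> g s" "(\<lambda>n. deriv (f n) s) \<longlonglongrightarrow> deriv g s" for s
    using lim[unfolded C1_loc_tendsto_def, rule_format, of "{s}"]
    by (auto intro: tendsto_uniform_limitI)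
  show "(\<lambda>n. f n b) \<longlonglongrightarrow> g b" by (rule pt)
  show "(\<lambda>n. f n a + deriv (f n) a * (b - a) - K / 2 * (b - a)\<^sup>2) \<longlonglongrightarrow>
      g a + deriv g a * (b - a) - K / 2 * (b - a)\<^sup>2"
    by (intro tendsto_intros pt)
qed (use semiconvex_tangent[OF f lb] in auto)

text \<open>By the mean value theorem A(q) - A(p) is A'(\<xi>) applied to q - p at a point \<xi> = p
  + s (q - p) with s > 0, and monotonicity compares A'(\<xi>) with A'(p) in that direction.\<close>

lemma monotone_gradient_tangent:
  fixes A :: "'a::euclidean_space \<Rightarrow> real"
  assumes grad: "\<And>p. GDERIV A p :> A' p"
    and mono: "\<And>p q. (A' p - A' q) \<bullet> (p - q) \<ge> 0"
  shows "A q \<ge> A p + A' p \<bullet> (q - p)"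
proof -
  define h where "h s = A (p + s *\<^sub>R (q - p))" for s :: real
  have D: "(h has_real_derivative (A' (p + s *\<^sub>R (q - p)) \<bullet> (q - p))) (at s)" for s
  proof -
    have "((\<lambda>s. p + s *\<^sub>R (q - p)) has_derivative (\<lambda>h. h *\<^sub>R (q - p))) (at s)"
      by (auto intro!: derivative_eq_intros)
    moreover have "(A has_derivative (\<lambda>h. h \<bullet> A' x)) (at x)" for x
      using grad by (simp add: gderiv_def)
    ultimately have "(h has_derivative (\<lambda>r. (r *\<^sub>R (q - p)) \<bullet> A' (p + s *\<^sub>R (q - p)))) (at s)"
      unfolding h_def by (rule has_derivative_compose)
    then show ?thesis
      by (auto simp: has_field_derivative_def inner_commute mult.commute elim!: has_derivative_eq_rhs)
  qed
  obtain s where s: "0 < s" "s < 1" "h 1 - h 0 = (1 - 0) * (A' (p + s *\<^sub>R (q - p)) \<bullet> (q - p))"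
    using MVT2[of 0 1 h, OF _ D] by auto
  have "0 \<le> (A' (p + s *\<^sub>R (q - p)) - A' p) \<bullet> (s *\<^sub>R (q - p))"
    using mono[of "p + s *\<^sub>R (q - p)" p] by simp
  with s(1) have "0 \<le> (A' (p + s *\<^sub>R (q - p)) - A' p) \<bullet> (q - p)"
    by (simp add: zero_le_mult_iff)
  with s(3) show ?thesis by (simp add: h_def inner_diff_left)
qed

text \<open>Growth at 0 forces \<open>A' 0 = 0\<close>, so the tangent at 0 bounds \<open>A\<close>
  below by \<open>A 0\<close>. The tangent at \<open>p\<close>, evaluated at 0, bounds
  \<open>A p\<close> above by \<open>A 0 + A' p \<bullet> p\<close>.\<close>

lemma monotone_gradient_quadratic_bound:
  fixes A :: "'a::euclidean_space \<Rightarrow> real"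
  assumes grad: "\<And>p. GDERIV A p :> A' p"
    and mono: "\<And>p q. (A' p - A' q) \<bullet> (p - q) \<ge> 0"
    and growth: "\<And>p. norm (A' p) \<le> K * norm p"
  shows "\<bar>A p\<bar> \<le> \<bar>A 0\<bar> + K * (norm p)\<^sup>2"
proof -
  have "A' 0 = 0" using growth[of 0] by simp
  then have "A 0 \<le> A p" using monotone_gradient_tangent[OF grad mono, of 0 p] by simp
  moreover have "A p \<le> A 0 + A' p \<bullet> p"
    using monotone_gradient_tangent[OF grad mono, of p 0] by simp
  moreover have "A' p \<bullet> p \<le> K * (norm p)\<^sup>2"
    using norm_cauchy_schwarz[of "A' p" p] mult_right_mono[OF growth[of p], of "norm p"]
    by (simp add: power2_eq_square)
  ultimately show ?thesis by linarith
qed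

text \<open>Carries continuity of the partial derivatives over to the given \<open>A'\<close>;
  measurability of \<open>A'\<close> along weak gradients rests on it.\<close>

lemma Ck_1_continuous_gradient:
  fixes A :: "'a::euclidean_space \<Rightarrow> real"
  assumes A: "Ck 1 A" and grad: "\<And>p. GDERIV A p :> A' p"
  shows "continuous_on UNIV A'"
proof -
  have "frechet_derivative A (at x) = (\<lambda>h. h \<bullet> A' x)" for x
    using grad[of x] frechet_derivative_at unfolding gderiv_def by metis
  with A have "continuous_on UNIV (\<lambda>x. A' x \<bullet> i)" if "i \<in> Basis" for i
    using that by (auto simp: inner_commute)
  then show ?thesis by (rule continuous_on_componentwise[THEN iffD2, rule_format])
qed

section \<open>Weak gradients\<close>

lemma finite_measure_lebesgue_on_bounded:
  "bounded \<Omega> \<Longrightarrow> \<Omega> \<in> sets lebesgue \<Longrightarrow> finite_measure (lebesgue_on \<Omega>)"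
  by (intro finite_measure_lebesgue_on bounded_set_imp_lmeasurable)

lemma L2_space_integrable_inner:
  assumes "f \<in> L2_space \<Omega>" "g \<in> L2_space \<Omega>"
  shows "integrable (lebesgue_on \<Omega>) (\<lambda>x. f x \<bullet> g x)"
proof (rule Bochner_Integration.integrable_bound)
  have [measurable]: "f \<in> borel_measurable (lebesgue_on \<Omega>)" "g \<in> borel_measurable (lebesgue_on \<Omega>)"
    using assms by (auto simp: L2_space_def)
  show "(\<lambda>x. f x \<bullet> g x) \<in> borel_measurable (lebesgue_on \<Omega>)" by measurable
  show "integrable (lebesgue_on \<Omega>) (\<lambda>x. (norm (f x))\<^sup>2 + (norm (g x))\<^sup>2)"
    using assms by (auto simp: L2_space_def)
  have "\<bar>u \<bullet> v\<bar> \<le> (norm u)\<^sup>2 + (norm v)\<^sup>2" for u v :: 'b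
    using Cauchy_Schwarz_ineq2[of u v] sum_squares_bound[of "norm u" "norm v"]
      mult_nonneg_nonneg[OF norm_ge_zero[of u] norm_ge_zero[of v]] by linarith
  then show "AE x in lebesgue_on \<Omega>. norm (f x \<bullet> g x) \<le> norm ((norm (f x))\<^sup>2 + (norm (g x))\<^sup>2)"
    by auto
qed

lemma L2_space_diff:
  assumes "f \<in> L2_space \<Omega>" "g \<in> L2_space \<Omega>"
  shows "(\<lambda>x. f x - g x) \<in> L2_space \<Omega>"
proof -
  have "(norm (f x - g x))\<^sup>2 = (norm (f x))\<^sup>2 - 2 * (f x \<bullet> g x) + (norm (g x))\<^sup>2" for x
    by (simp add: power2_norm_eq_inner inner_diff_left inner_diff_right inner_commute)
  with assms L2_space_integrable_inner[OF assms] show ?thesis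
    by (auto simp: L2_space_def)
qed

text \<open>Made for \<open>A'\<close> composed with a weak gradient, where linear growth supplies
  \<open>K\<close>.\<close>

lemma L2_space_norm_le:
  assumes "f \<in> L2_space \<Omega>" "g \<in> borel_measurable (lebesgue_on \<Omega>)"
    and le: "\<And>x. norm (g x) \<le> K * norm (f x)"
  shows "g \<in> L2_space \<Omega>"
proof -
  have [measurable]: "g \<in> borel_measurable (lebesgue_on \<Omega>)" by fact
  have "(norm (g x))\<^sup>2 \<le> K\<^sup>2 * (norm (f x))\<^sup>2" for x
    using power_mono[OF le[of x] norm_ge_zero, of 2] by (simp add: power_mult_distrib)
  moreover have "integrable (lebesgue_on \<Omega>) (\<lambda>x. K\<^sup>2 * (norm (f x))\<^sup>2)"
    using assms(1) by (auto simp: L2_space_def)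
  ultimately have "integrable (lebesgue_on \<Omega>) (\<lambda>x. (norm (g x))\<^sup>2)"
    by (elim Bochner_Integration.integrable_bound) auto
  with assms(2) show ?thesis by (simp add: L2_space_def)
qed

lemma L2_space_integrable:
  fixes f :: "'a::euclidean_space \<Rightarrow> 'b::euclidean_space"
  assumes f: "f \<in> L2_space \<Omega>" and "finite_measure (lebesgue_on \<Omega>)"
  shows "integrable (lebesgue_on \<Omega>) f"
proof (rule Bochner_Integration.integrable_bound)
  interpret finite_measure "lebesgue_on \<Omega>" by fact
  show "integrable (lebesgue_on \<Omega>) (\<lambda>x. 1 + (norm (f x))\<^sup>2)"
    using f by (auto simp: L2_space_def)
  have "r \<le> 1 + r\<^sup>2" if "r \<ge> 0" for r :: real
    using sum_squares_bound[of 1 r] that by (simp add: power2_eq_square)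
  then show "AE x in lebesgue_on \<Omega>. norm (f x) \<le> norm (1 + (norm (f x))\<^sup>2)" by auto
qed (use f in \<open>auto simp: L2_space_def\<close>)

text \<open>A continuous \<open>g\<close> is bounded on the compact closure of \<Omega>. This serves
  for products with test functions and their derivatives.\<close>

lemma integrable_mult_continuous_bounded:
  fixes f :: "'a::euclidean_space \<Rightarrow> real"
  assumes f: "integrable (lebesgue_on \<Omega>) f" and \<Omega>: "bounded \<Omega>" "\<Omega> \<in> sets lebesgue"
    and g: "continuous_on UNIV g"
  shows "integrable (lebesgue_on \<Omega>) (\<lambda>x. f x * g x)"
proof -
  have "compact (g ` closure \<Omega>)"
    using \<Omega> g by (intro compact_continuous_image) (auto intro: continuous_on_subset)
  then obtain B where B: "\<And>x. x \<in> closure \<Omega> \<Longrightarrow> norm (g x) \<le> B"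
    using compact_imp_bounded[of "g ` closure \<Omega>"] unfolding bounded_iff by auto
  have [measurable]: "f \<in> borel_measurable (lebesgue_on \<Omega>)" using f by auto
  have [measurable]: "g \<in> borel_measurable (lebesgue_on \<Omega>)"
    using g \<Omega> by (intro continuous_imp_measurable_on_sets_lebesgue) (auto intro: continuous_on_subset)
  show ?thesis
  proof (rule Bochner_Integration.integrable_bound)
    show "integrable (lebesgue_on \<Omega>) (\<lambda>x. B * f x)" using f by simp
    have "norm (f x * g x) \<le> norm (B * f x)" if "x \<in> \<Omega>" for x
    proof -
      have "norm (g x) \<le> \<bar>B\<bar>" using B[of x] that closure_subset[of \<Omega>] by force
      then show ?thesis by (simp add: abs_mult mult.commute[of "\<bar>f x\<bar>"] mult_right_mono)
    qed
    then show "AE x in lebesgue_on \<Omega>. norm (f x * g x) \<le> norm (B * f x)"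
      by (intro AE_I2) simp
  qed measurable
qed

section \<open>Linearity and uniqueness of weak gradients\<close>

lemma test_functions_continuous:
  assumes "\<phi> \<in> test_functions \<Omega>"
  shows "continuous_on UNIV \<phi>"
    and "i \<in> Basis \<Longrightarrow> continuous_on UNIV (\<lambda>x. frechet_derivative \<phi> (at x) i)"
proof -
  have "Ck k \<phi>" for k using assms by (simp add: test_functions_def)
  from this[of 0] this[of 1] show "continuous_on UNIV \<phi>"
    and "i \<in> Basis \<Longrightarrow> continuous_on UNIV (\<lambda>x. frechet_derivative \<phi> (at x) i)"
    by auto
qed

text \<open>The defining identity is linear; integrability of all four products is what permits
  splitting the Bochner integrals.\<close>

lemma has_weak_gradient_diff:
  assumes \<Omega>: "bounded \<Omega>" "\<Omega> \<in> sets lebesgue"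
    and y: "y \<in> L2_space \<Omega>" "z \<in> L2_space \<Omega>" and g: "g \<in> L2_space \<Omega>" "h \<in> L2_space \<Omega>"
    and "has_weak_gradient \<Omega> y g" "has_weak_gradient \<Omega> z h"
  shows "has_weak_gradient \<Omega> (\<lambda>x. y x - z x) (\<lambda>x. g x - h x)"
  unfolding has_weak_gradient_def
proof (intro ballI)
  fix \<phi> :: "'a \<Rightarrow> real" and i :: 'a
  assume \<phi>: "\<phi> \<in> test_functions \<Omega>" and i: "i \<in> Basis"
  note fin = finite_measure_lebesgue_on_bounded[OF \<Omega>]
  note int = integrable_mult_continuous_bounded[OF _ \<Omega>]
  have "integrable (lebesgue_on \<Omega>) (\<lambda>x. y x * frechet_derivative \<phi> (at x) i)"
    "integrable (lebesgue_on \<Omega>) (\<lambda>x. z x * frechet_derivative \<phi> (at x) i)"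
    using \<phi> i y fin by (intro int L2_space_integrable test_functions_continuous; simp)+
  moreover have "integrable (lebesgue_on \<Omega>) (\<lambda>x. (g x \<bullet> i) * \<phi> x)"
    "integrable (lebesgue_on \<Omega>) (\<lambda>x. (h x \<bullet> i) * \<phi> x)"
    using \<phi> g fin by (intro int integrable_inner_left L2_space_integrable test_functions_continuous; simp)+
  moreover have "(\<integral>x. y x * frechet_derivative \<phi> (at x) i \<partial>lebesgue_on \<Omega>) =
      - (\<integral>x. (g x \<bullet> i) * \<phi> x \<partial>lebesgue_on \<Omega>)"
    "(\<integral>x. z x * frechet_derivative \<phi> (at x) i \<partial>lebesgue_on \<Omega>) =
      - (\<integral>x. (h x \<bullet> i) * \<phi> x \<partial>lebesgue_on \<Omega>)"
    using assms(7,8) \<phi> i by (auto simp: has_weak_gradient_def)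
  ultimately show "(\<integral>x. (y x - z x) * frechet_derivative \<phi> (at x) i \<partial>lebesgue_on \<Omega>) =
      - (\<integral>x. ((g x - h x) \<bullet> i) * \<phi> x \<partial>lebesgue_on \<Omega>)"
    by (simp add: left_diff_distrib inner_diff_left)
qed

text \<open>Against a test function the components of both gradients have the same integral, fixed
  by \<open>y\<close>; the fundamental lemma applies to each component of
  \<open>g - h\<close>.\<close>

lemma has_weak_gradient_unique:
  assumes \<Omega>: "open \<Omega>" "bounded \<Omega>"
    and g: "g \<in> L2_space \<Omega>" "h \<in> L2_space \<Omega>"
    and "has_weak_gradient \<Omega> y g" "has_weak_gradient \<Omega> y h"
  shows "AE x in lebesgue_on \<Omega>. g x = h x"
proof -
  have \<Omega>L: "\<Omega> \<in> sets lebesgue" using \<Omega> by (simp add: borel_open)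
  note fin = finite_measure_lebesgue_on_bounded[OF \<Omega>(2) \<Omega>L]
  have "AE x in lebesgue_on \<Omega>. (g x - h x) \<bullet> i = 0" if i: "i \<in> Basis" for i
  proof (rule fundamental_lemma_variations[OF \<Omega>(1)])
    show "integrable (lebesgue_on \<Omega>) (\<lambda>x. (g x - h x) \<bullet> i)"
      using g fin by (intro integrable_inner_left L2_space_integrable L2_space_diff)
    fix \<phi> :: "'a \<Rightarrow> real" assume \<phi>: "\<phi> \<in> test_functions \<Omega>"
    have "integrable (lebesgue_on \<Omega>) (\<lambda>x. (g x \<bullet> i) * \<phi> x)"
      "integrable (lebesgue_on \<Omega>) (\<lambda>x. (h x \<bullet> i) * \<phi> x)"
      using \<phi> g fin \<Omega> \<Omega>L
      by (intro integrable_mult_continuous_bounded integrable_inner_left L2_space_integrable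
          test_functions_continuous; simp)+
    moreover have "(\<integral>x. (g x \<bullet> i) * \<phi> x \<partial>lebesgue_on \<Omega>) = (\<integral>x. (h x \<bullet> i) * \<phi> x \<partial>lebesgue_on \<Omega>)"
      using assms(5,6) \<phi> i by (fastforce simp: has_weak_gradient_def)
    ultimately show "(\<integral>x. (g x - h x) \<bullet> i * \<phi> x \<partial>lebesgue_on \<Omega>) = 0"
      by (simp add: left_diff_distrib inner_diff_left)
  qed
  then have "AE x in lebesgue_on \<Omega>. \<forall>i\<in>Basis. (g x - h x) \<bullet> i = 0"
    by (simp add: AE_finite_all)
  then show ?thesis
    by eventually_elim (simp add: inner_diff_left euclidean_eq_iff[where 'a='a])
qed

lemma weak_gradient_H1:
  assumes "y \<in> H1_space \<Omega>"
  shows "weak_gradient \<Omega> y \<in> L2_space \<Omega>" "has_weak_gradient \<Omega> y (weak_gradient \<Omega> y)"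
proof -
  have "\<exists>g. g \<in> L2_space \<Omega> \<and> has_weak_gradient \<Omega> y g"
    using assms by (auto simp: H1_space_def)
  from someI_ex[OF this] show "weak_gradient \<Omega> y \<in> L2_space \<Omega>"
    "has_weak_gradient \<Omega> y (weak_gradient \<Omega> y)"
    unfolding weak_gradient_def by auto
qed

text \<open>The choice \<open>weak_gradient\<close> makes for the difference is unrelated to its
  choices for \<open>y\<close> and \<open>z\<close>; uniqueness identifies them up to a null
  set.\<close>

lemma H1_space_diff:
  assumes \<Omega>: "open \<Omega>" "bounded \<Omega>" and y: "y \<in> H1_space \<Omega>" "z \<in> H1_space \<Omega>"
  shows "(\<lambda>x. y x - z x) \<in> H1_space \<Omega>"
    and "AE x in lebesgue_on \<Omega>. weak_gradient \<Omega> (\<lambda>x. y x - z x) x =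
           weak_gradient \<Omega> y x - weak_gradient \<Omega> z x"
proof -
  have \<Omega>L: "\<Omega> \<in> sets lebesgue" using \<Omega> by (simp add: borel_open)
  have L2: "y \<in> L2_space \<Omega>" "z \<in> L2_space \<Omega>" using y by (auto simp: H1_space_def)
  note grads = weak_gradient_H1[OF y(1)] weak_gradient_H1[OF y(2)]
  have hw: "has_weak_gradient \<Omega> (\<lambda>x. y x - z x) (\<lambda>x. weak_gradient \<Omega> y x - weak_gradient \<Omega> z x)"
    using \<Omega> \<Omega>L L2 grads by (intro has_weak_gradient_diff)
  have L2g: "(\<lambda>x. weak_gradient \<Omega> y x - weak_gradient \<Omega> z x) \<in> L2_space \<Omega>"
    using grads by (intro L2_space_diff)
  show H1: "(\<lambda>x. y x - z x) \<in> H1_space \<Omega>"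
    using L2_space_diff[OF L2] hw L2g by (auto simp: H1_space_def)
  show "AE x in lebesgue_on \<Omega>. weak_gradient \<Omega> (\<lambda>x. y x - z x) x =
      weak_gradient \<Omega> y x - weak_gradient \<Omega> z x"
    using has_weak_gradient_unique[OF \<Omega> weak_gradient_H1(1)[OF H1] L2g weak_gradient_H1(2)[OF H1] hw] .
qed

section \<open>Energy decay\<close>

lemma energy_density_integrable:
  fixes \<Omega> :: "'a::euclidean_space set" and A :: "'a \<Rightarrow> real"
  assumes \<Omega>: "bounded \<Omega>" "\<Omega> \<in> sets lebesgue"
    and A_C1: "Ck 1 A" and A_grad: "\<And>p. GDERIV A p :> A' p"
    and A_mono: "\<And>p q. (A' p - A' q) \<bullet> (p - q) \<ge> 0"
    and A_growth: "\<And>p. norm (A' p) \<le> L * norm p"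
    and y: "y \<in> H1_space \<Omega>" and psi_y: "integrable (lebesgue_on \<Omega>) (\<lambda>x. \<psi> (y x))"
  shows "integrable (lebesgue_on \<Omega>) (energy_density \<Omega> A \<psi> y)"
proof -
  interpret finite_measure "lebesgue_on \<Omega>"
    using \<Omega> by (rule finite_measure_lebesgue_on_bounded)
  note G = weak_gradient_H1(1)[OF y]
  have [measurable]: "weak_gradient \<Omega> y \<in> borel_measurable (lebesgue_on \<Omega>)"
    using G by (simp add: L2_space_def)
  have [measurable]: "A \<in> borel_measurable borel"
    using A_C1 Ck_SucD[of 0 A] by (simp add: borel_measurable_continuous_onI)
  \<comment> \<open>\<open>A\<close> grows at most quadratically, and the constant term of the bound
    is integrable because \<Omega> has finite measure.\<close>
  have "integrable (lebesgue_on \<Omega>) (\<lambda>x. A (weak_gradient \<Omega> y x))"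
  proof (rule Bochner_Integration.integrable_bound)
    show "integrable (lebesgue_on \<Omega>) (\<lambda>x. \<bar>A 0\<bar> + L * (norm (weak_gradient \<Omega> y x))\<^sup>2)"
      using G by (auto simp: L2_space_def)
    show "AE x in lebesgue_on \<Omega>. norm (A (weak_gradient \<Omega> y x)) \<le>
        norm (\<bar>A 0\<bar> + L * (norm (weak_gradient \<Omega> y x))\<^sup>2)"
      using monotone_gradient_quadratic_bound[OF A_grad A_mono A_growth]
      by (auto intro!: AE_I2 intro: order_trans[OF _ abs_ge_self])
  qed measurable
  with psi_y show ?thesis by (auto simp: energy_density_def[abs_def])
qed

text \<open>Here \<open>y\<close> is the new state, \<open>z\<close> the old one, \<open>s\<close>
  the step size, and \<open>eq\<close> the scheme with zero control tested with
  \<open>y - z\<close>. Integrability of \<psi>(y) is concluded as well, so that the step can be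
  iterated.\<close>

lemma energy_step:
  fixes \<Omega> :: "'a::euclidean_space set" and A :: "'a \<Rightarrow> real"
  assumes \<Omega>: "open \<Omega>" "bounded \<Omega>"
    and A_C1: "Ck 1 A" and A_grad: "\<And>p. GDERIV A p :> A' p"
    and A_mono: "\<And>p q. (A' p - A' q) \<bullet> (p - q) \<ge> 0"
    and A_growth: "\<And>p. norm (A' p) \<le> L * norm p"
    and psi_C1: "Ck 1 \<psi>" and psi_below: "bdd_below (range \<psi>)"
    and psi_tangent: "\<And>a b. \<psi> b \<ge> \<psi> a + deriv \<psi> a * (b - a) - K / 2 * (b - a)\<^sup>2"
    and y: "y \<in> H1_space \<Omega>" and z: "z \<in> H1_space \<Omega>"
    and psi_z: "integrable (lebesgue_on \<Omega>) (\<lambda>x. \<psi> (z x))"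
    and psi_int: "integrable (lebesgue_on \<Omega>) (\<lambda>x. deriv \<psi> (y x) * (y x - z x))"
    and s: "s > 0" "K * s \<le> 2"
    and eq: "L2_inner \<Omega> y (\<lambda>x. y x - z x)
          + s * L2_inner \<Omega> (\<lambda>x. A' (weak_gradient \<Omega> y x)) (weak_gradient \<Omega> (\<lambda>x. y x - z x))
          + s * L2_inner \<Omega> (\<lambda>x. deriv \<psi> (y x)) (\<lambda>x. y x - z x)
        = L2_inner \<Omega> z (\<lambda>x. y x - z x)"
  shows "integrable (lebesgue_on \<Omega>) (\<lambda>x. \<psi> (y x))"
    and "energy \<Omega> A \<psi> y \<le> energy \<Omega> A \<psi> z"
proof -
  have \<Omega>L: "\<Omega> \<in> sets lebesgue" using \<Omega> by (simp add: borel_open)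
  interpret finite_measure "lebesgue_on \<Omega>"
    using \<Omega>(2) \<Omega>L by (rule finite_measure_lebesgue_on_bounded)
  let ?\<phi> = "\<lambda>x. y x - z x"
  let ?G = "weak_gradient \<Omega> y" and ?H = "weak_gradient \<Omega> z"
  have L2: "y \<in> L2_space \<Omega>" "z \<in> L2_space \<Omega>" using y z by (auto simp: H1_space_def)
  note \<phi>L2 = L2_space_diff[OF L2]
  note GH = weak_gradient_H1(1)[OF y] weak_gradient_H1(1)[OF z]
  have [measurable]: "y \<in> borel_measurable (lebesgue_on \<Omega>)" "?G \<in> borel_measurable (lebesgue_on \<Omega>)"
    "?H \<in> borel_measurable (lebesgue_on \<Omega>)"
    "weak_gradient \<Omega> ?\<phi> \<in> borel_measurable (lebesgue_on \<Omega>)"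
    using L2 GH weak_gradient_H1(1)[OF H1_space_diff(1)[OF \<Omega> y z]] by (auto simp: L2_space_def)
  have [measurable]: "A' \<in> borel_measurable borel" "\<psi> \<in> borel_measurable borel"
    using Ck_1_continuous_gradient[OF A_C1 A_grad] psi_C1 Ck_SucD[of 0 \<psi>]
    by (auto intro: borel_measurable_continuous_onI)
  have sq: "integrable (lebesgue_on \<Omega>) (\<lambda>x. (?\<phi> x)\<^sup>2)"
    using \<phi>L2 by (simp add: L2_space_def)
  \<comment> \<open>The tangent is taken at the new value \<open>y x\<close>, where the implicit
    scheme evaluates the derivative of \<psi>.\<close>
  have psi_le: "\<psi> (y x) \<le> \<psi> (z x) + deriv \<psi> (y x) * ?\<phi> x + K / 2 * (?\<phi> x)\<^sup>2" for x
    using psi_tangent[of "y x" "z x"] by (simp add: power2_commute algebra_simps)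
  obtain m where m: "\<And>r. m \<le> \<psi> r"
    using psi_below by (auto simp: bdd_below_def)
  show psi_y: "integrable (lebesgue_on \<Omega>) (\<lambda>x. \<psi> (y x))"
  proof (rule Bochner_Integration.integrable_bound)
    show "integrable (lebesgue_on \<Omega>)
        (\<lambda>x. \<bar>m\<bar> + \<bar>\<psi> (z x) + deriv \<psi> (y x) * ?\<phi> x + K / 2 * (?\<phi> x)\<^sup>2\<bar>)"
      using psi_z psi_int sq by (intro Bochner_Integration.integrable_add integrable_abs integrable_mult_right) auto
    have "\<bar>\<psi> (y x)\<bar> \<le> \<bar>m\<bar> + \<bar>\<psi> (z x) + deriv \<psi> (y x) * ?\<phi> x + K / 2 * (?\<phi> x)\<^sup>2\<bar>" for x
      using psi_le[of x] m[of "y x"] by linarith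
    then show "AE x in lebesgue_on \<Omega>. norm (\<psi> (y x)) \<le>
        norm (\<bar>m\<bar> + \<bar>\<psi> (z x) + deriv \<psi> (y x) * ?\<phi> x + K / 2 * (?\<phi> x)\<^sup>2\<bar>)"
      by (intro AE_I2) (simp only: real_norm_def abs_of_nonneg abs_ge_zero add_nonneg_nonneg)
  qed measurable
  note density = energy_density_integrable[OF \<Omega>(2) \<Omega>L A_C1 A_grad A_mono A_growth]
  have A'G: "(\<lambda>x. A' (?G x)) \<in> L2_space \<Omega>"
    by (rule L2_space_norm_le[OF GH(1) _ A_growth]) measurable
  note A_int = L2_space_integrable_inner[OF A'G L2_space_diff[OF GH]]
  define I1 where "I1 = (\<integral>x. A' (?G x) \<bullet> (?G x - ?H x) \<partial>lebesgue_on \<Omega>)"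
  define I2 where "I2 = (\<integral>x. deriv \<psi> (y x) * ?\<phi> x \<partial>lebesgue_on \<Omega>)"
  define I3 where "I3 = (\<integral>x. (?\<phi> x)\<^sup>2 \<partial>lebesgue_on \<Omega>)"
  have "energy \<Omega> A \<psi> y - energy \<Omega> A \<psi> z =
      (\<integral>x. energy_density \<Omega> A \<psi> y x - energy_density \<Omega> A \<psi> z x \<partial>lebesgue_on \<Omega>)"
    unfolding energy_def
    by (rule Bochner_Integration.integral_diff[symmetric]; rule density; fact)
  also have "\<dots> \<le> (\<integral>x. A' (?G x) \<bullet> (?G x - ?H x) + deriv \<psi> (y x) * ?\<phi> x + K / 2 * (?\<phi> x)\<^sup>2 \<partial>lebesgue_on \<Omega>)"
  proof (rule integral_mono)
    show "integrable (lebesgue_on \<Omega>) (\<lambda>x. energy_density \<Omega> A \<psi> y x - energy_density \<Omega> A \<psi> z x)"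
      by (rule Bochner_Integration.integrable_diff; rule density; fact)
    show "integrable (lebesgue_on \<Omega>)
        (\<lambda>x. A' (?G x) \<bullet> (?G x - ?H x) + deriv \<psi> (y x) * ?\<phi> x + K / 2 * (?\<phi> x)\<^sup>2)"
      using A_int psi_int sq by auto
    fix x
    have "A (?G x) - A (?H x) \<le> A' (?G x) \<bullet> (?G x - ?H x)"
      using monotone_gradient_tangent[OF A_grad A_mono, of "?G x" "?H x"]
      by (simp add: inner_diff_right)
    with psi_le[of x] show "energy_density \<Omega> A \<psi> y x - energy_density \<Omega> A \<psi> z x \<le>
        A' (?G x) \<bullet> (?G x - ?H x) + deriv \<psi> (y x) * ?\<phi> x + K / 2 * (?\<phi> x)\<^sup>2"
      by (simp add: energy_density_def)
  qed
  also have "\<dots> = I1 + I2 + K / 2 * I3"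
    using A_int psi_int sq unfolding I1_def I2_def I3_def by simp
  finally have le: "energy \<Omega> A \<psi> y - energy \<Omega> A \<psi> z \<le> I1 + I2 + K / 2 * I3" .
  have "L2_inner \<Omega> (\<lambda>x. A' (?G x)) (weak_gradient \<Omega> ?\<phi>) = I1"
    unfolding L2_inner_def I1_def
  proof (rule integral_cong_AE)
    show "AE x in lebesgue_on \<Omega>. A' (?G x) \<bullet> weak_gradient \<Omega> ?\<phi> x = A' (?G x) \<bullet> (?G x - ?H x)"
      using H1_space_diff(2)[OF \<Omega> y z] by eventually_elim simp
  qed measurable
  moreover have "L2_inner \<Omega> (\<lambda>x. deriv \<psi> (y x)) ?\<phi> = I2"
    by (simp add: L2_inner_def I2_def)
  moreover have "L2_inner \<Omega> y ?\<phi> - L2_inner \<Omega> z ?\<phi> = I3"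
  proof -
    have "L2_inner \<Omega> y ?\<phi> - L2_inner \<Omega> z ?\<phi> = (\<integral>x. y x \<bullet> ?\<phi> x - z x \<bullet> ?\<phi> x \<partial>lebesgue_on \<Omega>)"
      unfolding L2_inner_def
      using L2 \<phi>L2 by (intro Bochner_Integration.integral_diff[symmetric] L2_space_integrable_inner)
    also have "\<dots> = I3"
      unfolding I3_def by (rule Bochner_Integration.integral_cong) (auto simp: power2_eq_square algebra_simps)
    finally show ?thesis .
  qed
  \<comment> \<open>The tested equation in terms of the three integrals. Eliminating
    \<open>I1\<close> and \<open>I2\<close> from \<open>s\<close> times the bound leaves
    \<open>(K * s / 2 - 1) * I3\<close>, whose sign is decided by the step size restriction.\<close>
  ultimately have "I3 + s * I1 + s * I2 = 0" using eq by simp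
  then have "s * (I1 + I2 + K / 2 * I3) = (K * s / 2 - 1) * I3"
    by (simp add: algebra_simps)
  moreover have "(K * s / 2 - 1) * I3 \<le> 0"
    using s by (intro mult_nonpos_nonneg) (auto simp: I3_def)
  ultimately have "I1 + I2 + K / 2 * I3 \<le> 0"
    using s(1) by (metis mult_pos_pos not_less)
  with le show "energy \<Omega> A \<psi> y \<le> energy \<Omega> A \<psi> z" by linarith
qed

section \<open>Induction along the time grid\<close>

lemma time_grid_in_interval:
  assumes grid: "time_grid T N t" and j: "j \<le> N"
  shows "t j \<in> {0..T}"
proof -
  have mono: "t i \<le> t k" if "i \<le> k" "k \<le> N" for i k
    using that
  proof (induction k rule: dec_induct)
    case (step n)
    have "t (Suc n - 1) < t (Suc n)"
      using grid step.prems unfolding time_grid_def by (metis Suc_le_mono atLeastAtMost_iff le0 One_nat_def)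
    with step show ?case by simp
  qed simp
  from mono[of 0 j] mono[of j N] grid j show ?thesis by (simp add: time_grid_def)
qed

text \<open>Integrability of the energy densities is part of the conclusion because a Bochner
  integral defaults to 0, so that the inequality alone could be vacuous. The step bound is
  conditional since \<open>2 / 0 = 0\<close> in HOL, whereas 1 / 0 is to be read as
  infinity.\<close>

theorem theorem2p8:
  fixes \<Omega> :: "(real ^ 'd) set" and T :: real and y0 :: "real ^ 'd \<Rightarrow> real"
    and A :: "real ^ 'd \<Rightarrow> real" and A' :: "real ^ 'd \<Rightarrow> real ^ 'd"
    and \<psi> :: "real \<Rightarrow> real" and f :: "nat \<Rightarrow> real \<Rightarrow> real"
    and C\<^sub>A Cbar\<^sub>A c C\<^sub>\<psi> :: real and C :: "nat \<Rightarrow> real"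
    and N :: nat and t :: "nat \<Rightarrow> real" and y :: "real \<Rightarrow> real ^ 'd \<Rightarrow> real"
  assumes domain: "bounded_lipschitz_domain \<Omega>"
    and T: "0 < T"
    and y0: "y0 \<in> H1_space \<Omega>"
    and A_C1: "Ck 1 A" and A_grad: "\<And>p. GDERIV A p :> A' p"
    and A_const: "C\<^sub>A > 0" "Cbar\<^sub>A > 0"
    and A_mono: "\<And>p q. (A' p - A' q) \<bullet> (p - q) \<ge> C\<^sub>A * (norm (p - q))\<^sup>2"
    and A_growth: "\<And>p. norm (A' p) \<le> Cbar\<^sub>A * norm p"
    and psi_C1: "Ck 1 \<psi>" and psi_below: "bdd_below (range \<psi>)"
    and psi_y0: "integrable (lebesgue_on \<Omega>) (\<lambda>x. \<psi> (y0 x))"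
    and const: "c \<ge> 0" "C\<^sub>\<psi> \<ge> 0" "\<And>n. C n \<ge> 0"
    and f_C2: "\<And>n. Ck 2 (f n)"
    and f_lim: "C1_loc_tendsto f \<psi>"
    and f_bounds: "\<And>n s. - c \<le> f n s" "\<And>n s. f n s \<le> c * (\<psi> s + 1)"
    and f_second: "\<And>n s. deriv (deriv (f n)) s \<ge> - C\<^sub>\<psi>" "\<And>n s. \<bar>deriv (deriv (f n)) s\<bar> \<le> C n"
    and grid: "time_grid T N t"
    and tau: "C\<^sub>\<psi> \<noteq> 0 \<Longrightarrow> max_step N t \<le> 2 / C\<^sub>\<psi>"
    and y: "y \<in> Y_space \<Omega> T N t"
    and solution: "scheme_solution \<Omega> A' (deriv \<psi>) N t y0 (\<lambda>s x. 0) y"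
  shows "(\<forall>j\<in>{0..N}. integrable (lebesgue_on \<Omega>) (energy_density \<Omega> A \<psi> (y (t j)))) \<and>
    (\<forall>j\<in>{1..N}. energy \<Omega> A \<psi> (y (t j)) \<le> energy \<Omega> A \<psi> (y (t (j - 1))))"
proof -
  have \<Omega>: "open \<Omega>" "bounded \<Omega>" using domain by (auto simp: bounded_lipschitz_domain_def)
  have \<Omega>L: "\<Omega> \<in> sets lebesgue" using \<Omega> by (simp add: borel_open)
  have mono: "(A' p - A' q) \<bullet> (p - q) \<ge> 0" for p q
    using A_mono[of p q] A_const(1) by (meson mult_nonneg_nonneg less_imp_le order_trans zero_le_power2)
  \<comment> \<open>\<open>Y_space\<close> constrains \<open>y\<close> only at times in
    \<open>{0..T}\<close>, so the grid points have to be located there.\<close>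
  have H1: "y (t j) \<in> H1_space \<Omega>" if "j \<le> N" for j
    using y time_grid_in_interval[OF grid that] by (simp add: Y_space_def)
  have step: "integrable (lebesgue_on \<Omega>) (\<lambda>x. \<psi> (y (t j) x)) \<and>
      energy \<Omega> A \<psi> (y (t j)) \<le> energy \<Omega> A \<psi> (y (t (j - 1)))"
    if j: "j \<in> {1..N}" and prev: "integrable (lebesgue_on \<Omega>) (\<lambda>x. \<psi> (y (t (j - 1)) x))" for j
  proof -
    let ?y = "y (t j)" and ?z = "y (t (j - 1))" and ?s = "step_size t j"
    let ?\<phi> = "\<lambda>x. ?y x - ?z x"
    have H1j: "?y \<in> H1_space \<Omega>" "?z \<in> H1_space \<Omega>" using j by (auto intro: H1)
    have s: "?s > 0" using grid j by (auto simp: time_grid_def step_size_def)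
    have "?s \<le> max_step N t" unfolding max_step_def using j by (intro Max_ge) auto
    then have Ks: "C\<^sub>\<psi> * ?s \<le> 2"
    proof (cases "C\<^sub>\<psi> = 0")
      case False
      with tau \<open>?s \<le> max_step N t\<close> have "?s \<le> 2 / C\<^sub>\<psi>" by simp
      with False const(2) show ?thesis by (simp add: pos_le_divide_eq mult.commute)
    qed simp
    \<comment> \<open>The scheme is tested with \<open>?\<phi>\<close>, which lies in H^1.
      Integrability of the \<psi>' term is part of being a solution, and the zero control removes
      the source term.\<close>
    have "integrable (lebesgue_on \<Omega>) (\<lambda>x. deriv \<psi> (?y x) * ?\<phi> x)"
      and "L2_inner \<Omega> ?y ?\<phi>
          + ?s * L2_inner \<Omega> (\<lambda>x. A' (weak_gradient \<Omega> ?y x)) (weak_gradient \<Omega> ?\<phi>)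
          + ?s * L2_inner \<Omega> (\<lambda>x. deriv \<psi> (?y x)) ?\<phi> = L2_inner \<Omega> ?z ?\<phi>"
      using solution j H1_space_diff(1)[OF \<Omega> H1j]
      by (auto simp: scheme_solution_def L2_inner_def[of \<Omega> "\<lambda>x. 0"])
    from energy_step[OF \<Omega> A_C1 A_grad mono A_growth psi_C1 psi_below
        semiconvex_tangent_limit[OF f_C2 f_second(1) f_lim] H1j prev this(1) s Ks this(2)]
    show ?thesis by blast
  qed
  have psi_int: "integrable (lebesgue_on \<Omega>) (\<lambda>x. \<psi> (y (t j) x))" if "j \<le> N" for j
    using that
  proof (induction j)
    case 0
    \<comment> \<open>Since \<open>t 0 = 0\<close>, the initial condition applies; it holds only
      almost everywhere, so integrability is transferred from \<open>y0\<close> by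
      measurability.\<close>
    have ae: "AE x in lebesgue_on \<Omega>. y (t 0) x = y0 x"
      using solution grid by (simp add: scheme_solution_def time_grid_def)
    have [measurable]: "y (t 0) \<in> borel_measurable (lebesgue_on \<Omega>)"
      using H1[of 0] by (simp add: H1_space_def L2_space_def)
    have [measurable]: "\<psi> \<in> borel_measurable borel"
      using psi_C1 Ck_SucD[of 0 \<psi>] by (simp add: borel_measurable_continuous_onI)
    have "AE x in lebesgue_on \<Omega>. \<psi> (y (t 0) x) = \<psi> (y0 x)"
      using ae by eventually_elim simp
    then show ?case
      using integrable_cong_AE[of "\<lambda>x. \<psi> (y (t 0) x)" "lebesgue_on \<Omega>" "\<lambda>x. \<psi> (y0 x)"] psi_y0
      by auto
  next
    case (Suc j)
    then show ?case using step[of "Suc j"] by simp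
  qed
  have "integrable (lebesgue_on \<Omega>) (energy_density \<Omega> A \<psi> (y (t j)))" if "j \<in> {0..N}" for j
    using that
    by (intro energy_density_integrable[OF \<Omega>(2) \<Omega>L A_C1 A_grad mono A_growth] H1 psi_int) auto
  moreover have "energy \<Omega> A \<psi> (y (t j)) \<le> energy \<Omega> A \<psi> (y (t (j - 1)))" if "j \<in> {1..N}" for j
    using step[OF that psi_int[of "j - 1"]] that by auto
  ultimately show ?thesis by blast
qed

end
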